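(* One has $$\ln\frac{4}{\pi} = \sum_{n=1}^{\infty}(-1)^{n-1}\left(\frac{1}{n}-\ln\frac{n+1}{n}\right) = \iint_{[0,1]^2}\frac{1-x}{(1+xy)(-\ln xy)}\,dx\,dy .$$
   Context: Here $\ln$ is the natural logarithm and $\ln xy$ means $\ln(xy)$. The integrand is defined for $0<x<1$, $0<y<1$, i.e. almost everywhere on the unit square, and the (improper) double integral is taken over the unit square $[0,1]^2$. *)

theory Defs
  imports "HOL-Analysis.Analysis"
begin

(* Where x * y = 0, and at (1, 1), the value is 0 by the conventions ln 0 = 0 and a / 0 = 0;
   within the closed unit square this concerns only a Lebesgue null set. *)
definition integrand :: "real \<times> real \<Rightarrow> real" where
  "integrand = (\<lambda>(x, y). (1 - x) / ((1 + x * y) * (- ln (x * y))))"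

end

theory Submission
  imports Defs "HOL-Real_Asymp.Real_Asymp"
begin

text \<open>
  Write \<open>gap n = 1/n - ln ((n+1)/n)\<close>. The alternating series of the \<open>1/n\<close> is \<open>ln 2\<close>, and the
  alternating series of the \<open>ln ((n+1)/n)\<close> is the logarithm of Wallis' product, hence
  \<open>ln (\<pi>/2)\<close>; the difference is \<open>ln (4/\<pi>)\<close>.

  For the integral, \<open>1/(1+xy)\<close> is expanded as a geometric series, which leads to the functions
  \<open>(1-x) (xy)^n / (- ln (xy))\<close>. Since \<open>u^n / (- ln u)\<close> is the integral of \<open>u powr (n+t)\<close> over
  \<open>t \<ge> 0\<close>, Tonelli's theorem lets one integrate first over \<open>y\<close>, then over \<open>x\<close>, which leaves
  \<open>1 / ((n+t+1)^2 (n+t+2))\<close>, and then over \<open>t\<close> by partial fractions. The result is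
  \<open>gap (n+1)\<close> (lemma \<open>nn_integral_moment\<close>).

  The geometric series of \<open>-xy\<close> alternates, so it is summed in consecutive pairs: with
  \<open>1/(1+u) = (1-u) (1 + u^2 + u^4 + \<dots>)\<close> the integrand is a series of nonnegative functions
  (lemma \<open>paired_moments_sums\<close>) whose integrals \<open>gap (2k+1) - gap (2k+2)\<close> add up to the grouped
  alternating series. This gives integrability and the value of the integral together.
\<close>

section \<open>The alternating series\<close>

text \<open>The absolute value of the \<open>n\<close>-th term of the series, meaningful for \<open>n \<ge> 1\<close>.\<close>
definition gap :: "nat \<Rightarrow> real" where
  "gap n = 1 / real n - ln ((real n + 1) / real n)"

lemma ln_succ_quotient_bounds:
  assumes "n > 0"
  shows "1 / (real n + 1) \<le> ln ((real n + 1) / real n)"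
    and "ln ((real n + 1) / real n) \<le> 1 / real n"
proof -
  have "ln (real n / (real n + 1)) \<le> real n / (real n + 1) - 1"
    using assms by (intro ln_le_minus_one) simp
  also have "\<dots> = - (1 / (real n + 1))"
    by (simp add: field_simps)
  finally show "1 / (real n + 1) \<le> ln ((real n + 1) / real n)"
    using assms by (simp add: ln_div)
  have "ln ((real n + 1) / real n) \<le> (real n + 1) / real n - 1"
    using assms by (intro ln_le_minus_one) simp
  also have "\<dots> = 1 / real n"
    using assms by (simp add: field_simps)
  finally show "ln ((real n + 1) / real n) \<le> 1 / real n" .
qed

lemma gap_nonneg: "n > 0 \<Longrightarrow> gap n \<ge> 0"
  using ln_succ_quotient_bounds(2) by (simp add: gap_def)

lemma ln_succ_quotient_antimono:
  assumes "n > 0"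
  shows "ln ((real (Suc n) + 1) / real (Suc n)) \<le> ln ((real n + 1) / real n)"
  using ln_succ_quotient_bounds(2)[of "Suc n"] ln_succ_quotient_bounds(1)[OF assms]
  by (simp add: add.commute)

text \<open>Convergence is Leibniz's criterion, so the value may be read off from the partial sums of
  even length.\<close>
lemma alternating_ln_wallis:
  "(\<lambda>k. (-1) ^ k * ln ((real (Suc k) + 1) / real (Suc k))) sums ln (pi / 2)"
proof -
  define a where "a k = ln ((real (Suc k) + 1) / real (Suc k))" for k :: nat
  have "(\<lambda>k. 1 / real (Suc k)) \<longlonglongrightarrow> 0"
    using LIMSEQ_inverse_real_of_nat by (simp add: inverse_eq_divide)
  then have lim0: "a \<longlonglongrightarrow> 0"
  proof (rule tendsto_sandwich[OF _ _ tendsto_const, rotated 2])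
    show "\<forall>\<^sub>F k in sequentially. 0 \<le> a k"
      by (auto simp: a_def)
    show "\<forall>\<^sub>F k in sequentially. a k \<le> 1 / real (Suc k)"
      unfolding a_def by (intro always_eventually allI ln_succ_quotient_bounds(2)) simp
  qed
  have "decseq a"
    unfolding a_def by (intro decseq_SucI ln_succ_quotient_antimono) simp
  with lim0 have "summable (\<lambda>k. (-1) ^ k * a k)"
    by (intro summable_Leibniz(1) decseq_imp_monoseq)
  then obtain S where S: "(\<lambda>k. (-1) ^ k * a k) sums S"
    by (auto simp: summable_def)
  have "(\<lambda>m. \<Sum>k<2 * m. (-1) ^ k * a k) \<longlonglongrightarrow> S"
    using S unfolding sums_def
    by (rule filterlim_compose) (rule mult_nat_left_at_top, simp)
  moreover have "(\<Sum>k<2 * m. (-1) ^ k * a k)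
      = ln (\<Prod>k=1..m. (4 * real k ^ 2) / (4 * real k ^ 2 - 1))" for m
  proof (induction m)
    case (Suc m)
    define P where "P = (\<Prod>k=1..m. (4 * real k ^ 2) / (4 * real k ^ 2 - 1))"
    have pos: "4 * real k ^ 2 - 1 > 0" if "k \<ge> 1" for k :: nat
    proof -
      have "real k ^ 2 \<ge> 1" using that by simp
      then show ?thesis by linarith
    qed
    have "P > 0"
      unfolding P_def using pos by (intro prod_pos divide_pos_pos) auto
    have "a (2 * m) - a (2 * m + 1)
        = ln ((4 * real (Suc m) ^ 2) / (4 * real (Suc m) ^ 2 - 1))"
    proof -
      have e: "4 * real (Suc m) ^ 2 / (4 * real (Suc m) ^ 2 - 1)
          = ((real (2*m+1) + 1) / real (2*m+1)) / ((real (2*m+2) + 1) / real (2*m+2))"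
        using pos[of "Suc m"] by (simp add: field_simps power2_eq_square)
      have "ln (((real (2*m+1) + 1) / real (2*m+1)) / ((real (2*m+2) + 1) / real (2*m+2)))
          = ln ((real (2*m+1) + 1) / real (2*m+1)) - ln ((real (2*m+2) + 1) / real (2*m+2))"
        by (rule ln_divide_pos) auto
      then show ?thesis unfolding e by (simp add: a_def)
    qed
    moreover have "ln (P * ((4 * real (Suc m) ^ 2) / (4 * real (Suc m) ^ 2 - 1)))
        = ln P + ln ((4 * real (Suc m) ^ 2) / (4 * real (Suc m) ^ 2 - 1))"
      using \<open>P > 0\<close> pos[of "Suc m"] by (intro ln_mult_pos divide_pos_pos) auto
    ultimately show ?case
      using Suc by (simp add: P_def)
  qed simp
  moreover have "(\<lambda>m. ln (\<Prod>k=1..m. (4 * real k ^ 2) / (4 * real k ^ 2 - 1))) \<longlonglongrightarrow> ln (pi / 2)"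
    by (intro tendsto_ln wallis) simp
  ultimately have "S = ln (pi / 2)"
    by (simp add: LIMSEQ_unique)
  with S show ?thesis by (simp add: a_def)
qed

lemma alternating_gap_sums: "(\<lambda>k. (-1) ^ k * gap (Suc k)) sums ln (4 / pi)"
proof -
  have "ln 2 - ln (pi / 2) = ln (2 / (pi / 2))"
    by (rule ln_divide_pos [symmetric]) auto
  also have "2 / (pi / 2) = 4 / pi"
    by simp
  finally have "ln 2 - ln (pi / 2) = ln (4 / pi)" .
  moreover have "(-1) ^ k * gap (Suc k)
     = (-1) ^ k / real (Suc k) - (-1) ^ k * ln ((real (Suc k) + 1) / real (Suc k))" for k
    by (simp add: gap_def algebra_simps)
  ultimately show ?thesis
    using sums_diff[OF alternating_harmonic_series_sums alternating_ln_wallis] by simp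
qed

section \<open>One-dimensional integrals\<close>

text \<open>The case \<open>u = 0\<close> holds because \<open>0 powr s = 0\<close> and \<open>ln 0 = 0\<close>, so that both sides are \<open>0\<close>.\<close>
lemma nn_integral_powr_exponent:
  fixes u :: real
  assumes "0 \<le> u" "u < 1"
  shows "(\<integral>\<^sup>+ t. ennreal (u powr (real n + t)) * indicator {0..} t \<partial>lborel)
    = ennreal (u ^ n / (- ln u))"
proof (cases "u = 0")
  case False
  with assms have u: "0 < u" "ln u < 0" by auto
  have "(\<integral>\<^sup>+ t. ennreal (u powr (real n + t)) * indicator {0..} t \<partial>lborel)
      = ennreal (0 - u powr (real n + 0) / ln u)"
  proof (rule nn_integral_FTC_atLeast)
    show "((\<lambda>t. u powr (real n + t) / ln u) has_real_derivative u powr (real n + t)) (at t)" for t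
      unfolding powr_def using u by (auto intro!: derivative_eq_intros)
    have "((\<lambda>t. u powr (real n + t)) \<longlongrightarrow> 0) at_top"
      unfolding powr_def using u
      by (auto intro!: filterlim_compose[OF exp_at_bot] filterlim_tendsto_neg_mult_at_bot
          simp: mult.commute[of _ "ln u"] filterlim_tendsto_add_at_top[OF tendsto_const filterlim_ident])
    from tendsto_divide[OF this tendsto_const[of "ln u"]] u
    show "((\<lambda>t. u powr (real n + t) / ln u) \<longlongrightarrow> 0) at_top" by simp
  qed auto
  then show ?thesis using u by (simp add: powr_realpow)
qed auto

lemma nn_integral_powr_unit:
  assumes "s \<ge> (0::real)"
  shows "(\<integral>\<^sup>+ x. ennreal (x powr s) * indicator {0..1} x \<partial>lborel) = ennreal (1 / (s + 1))"
  using has_integral_powr_from_0[of s 1] assms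
  by (intro nn_integral_has_integral_lebesgue') auto

lemma nn_integral_one_minus_times_powr_unit:
  assumes "s \<ge> (0::real)"
  shows "(\<integral>\<^sup>+ x. ennreal ((1 - x) * x powr s) * indicator {0..1} x \<partial>lborel)
    = ennreal (1 / ((s + 1) * (s + 2)))"
proof (rule nn_integral_has_integral_lebesgue')
  have "((\<lambda>x. x powr s - x powr (s + 1)) has_integral
      (1 powr (s + 1) / (s + 1) - 1 powr (s + 1 + 1) / (s + 1 + 1))) {0..1}"
    using assms by (intro has_integral_diff has_integral_powr_from_0) auto
  moreover have "1 powr (s + 1) / (s + 1) - 1 powr (s + 1 + 1) / (s + 1 + 1)
      = 1 / ((s + 1) * (s + 2))"
    using assms by (simp add: field_simps)
  ultimately show "((\<lambda>x. (1 - x) * x powr s) has_integral 1 / ((s + 1) * (s + 2))) {0..1}"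
    by (elim has_integral_eq_rhs [THEN has_integral_eq [rotated]])
      (auto simp: powr_add algebra_simps)
qed auto

lemma nn_integral_gap:
  "(\<integral>\<^sup>+ t. ennreal (1 / ((real n + t + 1) ^ 2 * (real n + t + 2))) * indicator {0..} t \<partial>lborel)
    = ennreal (gap (Suc n))"
proof -
  \<comment> \<open>With \<open>a = n + t + 1\<close>, the integrand is \<open>1/a^2 - 1/a + 1/(a+1)\<close>.\<close>
  define F where "F t = ln (real n + t + 2) - ln (real n + t + 1) - 1 / (real n + t + 1)" for t
  have "(\<integral>\<^sup>+ t. ennreal (1 / ((real n + t + 1) ^ 2 * (real n + t + 2))) * indicator {0..} t \<partial>lborel)
    = ennreal (0 - F 0)"
  proof (rule nn_integral_FTC_atLeast)
    fix t :: real assume t: "0 \<le> t"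
    define a where "a = real n + t + 1"
    have a: "a > 0" "real n + t + 1 = a" "real n + t + 2 = a + 1" using t by (auto simp: a_def)
    have "(F has_real_derivative 1 / (real n + t + 2) - 1 / (real n + t + 1)
        + 1 / (real n + t + 1) ^ 2) (at t)"
      unfolding F_def using t
      by (auto intro!: derivative_eq_intros simp: power2_eq_square)
    then have "(F has_real_derivative 1 / (a + 1) - 1 / a + 1 / a ^ 2) (at t)"
      by (simp only: a)
    also have "1 / (a + 1) - 1 / a + 1 / a ^ 2 = 1 / (a ^ 2 * (a + 1))"
      using a by (simp add: divide_simps) (simp add: algebra_simps power2_eq_square)
    finally show "(F has_real_derivative 1 / ((real n + t + 1) ^ 2 * (real n + t + 2))) (at t)"
      by (simp add: a)
    show "0 \<le> 1 / ((real n + t + 1) ^ 2 * (real n + t + 2))"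
      using t by simp
  next
    have "((\<lambda>t. ln (t + 2) - ln (t + 1) - 1 / (t + 1)) \<longlongrightarrow> (0::real)) at_top"
      by real_asymp
    then have "((\<lambda>t. (\<lambda>t. ln (t + 2) - ln (t + 1) - 1 / (t + 1)) (real n + t)) \<longlongrightarrow> 0) at_top"
      by (rule filterlim_compose)
        (rule filterlim_tendsto_add_at_top[OF tendsto_const filterlim_ident])
    then show "(F \<longlongrightarrow> 0) at_top"
      by (simp add: F_def[abs_def])
  qed auto
  also have "0 - F 0 = gap (Suc n)"
    by (simp add: F_def gap_def ln_div add_ac)
  finally show ?thesis .
qed

section \<open>Integrals over the unit square\<close>

text \<open>The coefficient functions of the expansion of the integrand, extended by \<open>0\<close> to the plane.
  The indicator is that of the closed square: where \<open>x * y = 0\<close> and at \<open>(1, 1)\<close>, division by zero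
  gives the value \<open>0\<close>, which is also what the identities below require there, so no
  null set has to be removed.\<close>
definition moment :: "nat \<Rightarrow> real \<times> real \<Rightarrow> real" where
  "moment n = (\<lambda>(x, y). indicator ({0..1} \<times> {0..1}) (x, y) *
     ((1 - x) * ((x * y) ^ n / (- ln (x * y)))))"

lemma moment_measurable [measurable]: "moment n \<in> borel_measurable borel"
proof -
  have "{0..1} \<times> {0..1} \<in> sets (borel :: (real \<times> real) measure)"
    by (intro borel_closed closed_Times) auto
  then show ?thesis
    unfolding moment_def borel_prod[symmetric] case_prod_beta by measurable
qed

lemma mult_less_1_unit:
  fixes x y :: real
  assumes "x \<in> {0..1}" "y \<in> {0..1}" "x \<noteq> 1"
  shows "x * y < 1"
proof -
  have "x * y \<le> x * 1" using assms by (intro mult_left_mono) auto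
  then show ?thesis using assms by auto
qed

lemma moment_nonneg: "moment n p \<ge> 0"
proof (cases p)
  case (Pair x y)
  have "- ln (x * y) \<ge> 0" if "x \<in> {0..1}" "y \<in> {0..1}"
    using that mult_le_one[of x y] by (cases "x * y = 0") auto
  then have "0 \<le> (1 - x) * ((x * y) ^ n / (- ln (x * y)))" if "x \<in> {0..1}" "y \<in> {0..1}"
    using that by (intro mult_nonneg_nonneg divide_nonneg_nonneg) auto
  then show ?thesis
    by (simp add: moment_def Pair indicator_def)
qed

lemma nn_integral_moment: "(\<integral>\<^sup>+ p. ennreal (moment n p) \<partial>lborel) = ennreal (gap (Suc n))"
proof -
  define K where "K x y t = ennreal ((1 - x) * (x * y) powr (real n + t))
      * indicator {0..1} x * indicator {0..1} y * indicator {0..} t" for x y t :: real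
  have K_meas [measurable]: "(\<lambda>p. K (f p) (g p) (h p)) \<in> borel_measurable M"
    if "f \<in> borel_measurable M" "g \<in> borel_measurable M" "h \<in> borel_measurable M"
    for f g h and M :: "'z measure"
    using that unfolding K_def by measurable
  \<comment> \<open>At \<open>x = 1\<close>, in particular at \<open>(1, 1)\<close>, both sides vanish; elsewhere on the square \<open>x * y < 1\<close>.\<close>
  have t: "ennreal (moment n (x, y)) = (\<integral>\<^sup>+ t. K x y t \<partial>lborel)" for x y
  proof (cases "x \<in> {0..1} \<and> y \<in> {0..1} \<and> x \<noteq> 1")
    case True
    then have "x * y < 1" by (intro mult_less_1_unit) auto
    have "(\<integral>\<^sup>+ t. K x y t \<partial>lborel)
       = (\<integral>\<^sup>+ t. ennreal (1 - x) * (ennreal ((x * y) powr (real n + t)) * indicator {0..} t) \<partial>lborel)"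
      unfolding K_def using True by (intro nn_integral_cong) (simp add: ennreal_mult mult_ac)
    also have "\<dots> = ennreal (1 - x) * ennreal ((x * y) ^ n / (- ln (x * y)))"
      using True \<open>x * y < 1\<close> by (subst nn_integral_cmult) (auto simp: nn_integral_powr_exponent)
    also have "\<dots> = ennreal ((1 - x) * ((x * y) ^ n / (- ln (x * y))))"
      using True by (intro ennreal_mult' [symmetric]) auto
    finally show ?thesis using True by (simp add: moment_def)
  next
    case False
    then have "K x y t = 0" for t
      by (auto simp: K_def indicator_def)
    with False show ?thesis
      by (auto simp: moment_def indicator_def)
  qed
  have y: "(\<integral>\<^sup>+ y. K x y t \<partial>lborel) = ennreal (1 / (real n + t + 1)) *
      (ennreal ((1 - x) * x powr (real n + t)) * indicator {0..1} x) * indicator {0..} t" for x t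
  proof (cases "x \<in> {0..1} \<and> t \<ge> 0")
    case True
    have "(\<integral>\<^sup>+ y. K x y t \<partial>lborel) = (\<integral>\<^sup>+ y. ennreal ((1 - x) * x powr (real n + t)) *
        (ennreal (y powr (real n + t)) * indicator {0..1} y) \<partial>lborel)"
      unfolding K_def using True
      by (intro nn_integral_cong) (auto simp: indicator_def powr_mult ennreal_mult mult_ac)
    also have "\<dots> = ennreal ((1 - x) * x powr (real n + t)) * ennreal (1 / (real n + t + 1))"
      using True by (subst nn_integral_cmult) (auto simp: nn_integral_powr_unit)
    finally show ?thesis using True by (simp add: mult_ac)
  next
    case False
    then show ?thesis by (auto simp: K_def indicator_def)
  qed
  have x: "(\<integral>\<^sup>+ x. \<integral>\<^sup>+ y. K x y t \<partial>lborel \<partial>lborel)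
      = ennreal (1 / ((real n + t + 1) ^ 2 * (real n + t + 2))) * indicator {0..} t" for t
  proof (cases "t \<ge> 0")
    case True
    have "(\<integral>\<^sup>+ x. \<integral>\<^sup>+ y. K x y t \<partial>lborel \<partial>lborel) = ennreal (1 / (real n + t + 1)) *
       ennreal (1 / ((real n + t + 1) * (real n + t + 2)))"
      unfolding y using True
      by (simp add: nn_integral_cmult nn_integral_one_minus_times_powr_unit)
    also have "\<dots> = ennreal (1 / ((real n + t + 1) ^ 2 * (real n + t + 2)))"
      using True by (subst ennreal_mult' [symmetric]) (auto simp: power2_eq_square mult_ac)
    finally show ?thesis using True by simp
  next
    case False
    then show ?thesis by (simp add: y)
  qed
  have "(\<integral>\<^sup>+ p. ennreal (moment n p) \<partial>lborel) = (\<integral>\<^sup>+ x. \<integral>\<^sup>+ y. ennreal (moment n (x, y)) \<partial>lborel \<partial>lborel)"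
    unfolding lborel_prod[symmetric]
    by (rule lborel.nn_integral_fst [symmetric]) (simp add: lborel_prod)
  also have "\<dots> = (\<integral>\<^sup>+ x. \<integral>\<^sup>+ y. \<integral>\<^sup>+ t. K x y t \<partial>lborel \<partial>lborel \<partial>lborel)"
    by (simp only: t)
  also have "\<dots> = (\<integral>\<^sup>+ x. \<integral>\<^sup>+ t. \<integral>\<^sup>+ y. K x y t \<partial>lborel \<partial>lborel \<partial>lborel)"
    by (intro nn_integral_cong lborel_pair.Fubini') measurable
  also have "\<dots> = (\<integral>\<^sup>+ t. \<integral>\<^sup>+ x. \<integral>\<^sup>+ y. K x y t \<partial>lborel \<partial>lborel \<partial>lborel)"
    by (intro lborel_pair.Fubini') measurable
  also have "\<dots> = ennreal (gap (Suc n))"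
    unfolding x by (rule nn_integral_gap)
  finally show ?thesis .
qed

lemma has_bochner_integral_moment: "has_bochner_integral lborel (moment n) (gap (Suc n))"
  by (intro has_bochner_integral_nn_integral nn_integral_moment)
    (auto simp: moment_nonneg gap_nonneg)

lemma moment_Suc_le: "moment (Suc n) p \<le> moment n p"
proof (cases p)
  case (Pair x y)
  have "moment (Suc n) p = (x * y) * moment n p"
    by (simp add: moment_def Pair)
  also have "\<dots> \<le> moment n p"
  proof (cases "x \<in> {0..1} \<and> y \<in> {0..1}")
    case True
    then show ?thesis
      using mult_le_one[of x y] by (intro mult_left_le_one_le moment_nonneg) auto
  next
    case False
    then show ?thesis by (auto simp: moment_def Pair indicator_def)
  qed
  finally show ?thesis .
qed

section \<open>Termwise integration\<close>

text \<open>This holds at every point, not only almost everywhere. With \<open>u = x * y < 1\<close> the series is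
  geometric with ratio \<open>u^2\<close>; on the side \<open>x = 1\<close> all terms vanish.\<close>
lemma paired_moments_sums:
  "(\<lambda>k. moment (2 * k) p - moment (2 * k + 1) p) sums
     (indicator ({0..1} \<times> {0..1}) p * integrand p)"
proof (cases p)
  case (Pair x y)
  show ?thesis
  proof (cases "x \<in> {0..1} \<and> y \<in> {0..1} \<and> x \<noteq> 1")
    case True
    define u where "u = x * y"
    define c where "c = (1 - x) / (- ln u)"
    have u: "0 \<le> u" "u < 1"
      using True mult_less_1_unit[of x y] by (auto simp: u_def)
    then have "u ^ 2 < 1"
      by (simp add: power_less_one_iff)
    then have "(\<lambda>k. c * (1 - u) * (u ^ 2) ^ k) sums (c * (1 - u) * (1 / (1 - u ^ 2)))"
      using u by (intro sums_mult geometric_sums) simp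
    moreover have "c * (1 - u) * (1 / (1 - u ^ 2)) = c / (1 + u)"
    proof -
      have "1 - u ^ 2 = (1 - u) * (1 + u)"
        by (simp add: algebra_simps power2_eq_square)
      then show ?thesis using u by simp
    qed
    moreover have "c / (1 + u) = indicator ({0..1} \<times> {0..1}) p * integrand p"
      using True by (simp add: Pair integrand_def c_def u_def mult.commute)
    moreover have "moment (2 * k) p - moment (2 * k + 1) p = c * (1 - u) * (u ^ 2) ^ k" for k
    proof -
      have "moment j p = c * u ^ j" for j
        using True by (simp add: moment_def Pair c_def u_def)
      then show ?thesis
        by (simp add: power_mult [symmetric] algebra_simps)
    qed
    ultimately show ?thesis by simp
  next
    case False
    then show ?thesis
      by (auto simp: moment_def integrand_def Pair indicator_def)
  qed
qed

theorem mainTheorem2: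
  shows "(\<lambda>k. let n = Suc k in
            (-1) ^ (n - 1) * (1 / real n - ln ((real n + 1) / real n))) sums ln (4 / pi) \<and>
         set_integrable lborel ({0..1} \<times> {0..1}) integrand \<and>
         (LINT p : {0..1} \<times> {0..1} | lborel. integrand p) = ln (4 / pi)"
proof -
  define D where "D k p = moment (2 * k) p - moment (2 * k + 1) p" for k p
  define h where "h p = indicator ({0..1} \<times> {0..1}) p * integrand p" for p
  define d where "d k = gap (2 * k + 1) - gap (2 * k + 2)" for k
  have D_int: "has_bochner_integral lborel (D k) (d k)" for k
    unfolding D_def d_def
    using has_bochner_integral_diff[OF has_bochner_integral_moment[of "2 * k"]
        has_bochner_integral_moment[of "2 * k + 1"]] by simp
  have D_nonneg: "D k p \<ge> 0" for k p
    using moment_Suc_le[of "2 * k" p] by (simp add: D_def)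
  have D_sums: "(\<lambda>k. D k p) sums h p" for p
    unfolding D_def h_def by (rule paired_moments_sums)
  \<comment> \<open>Grouping consecutive terms of the alternating series.\<close>
  have d_sums: "d sums ln (4 / pi)"
  proof -
    have "(\<lambda>k. \<Sum>j = k * 2..<k * 2 + 2. (-1) ^ j * gap (Suc j)) sums ln (4 / pi)"
      by (rule sums_group[OF alternating_gap_sums]) simp
    moreover have "(\<Sum>j = k * 2..<k * 2 + 2. (-1) ^ j * gap (Suc j)) = d k" for k
      by (simp add: d_def mult.commute[of k 2])
    ultimately show ?thesis by simp
  qed
  have D_integrable: "integrable lborel (D k)" and D_integral: "integral\<^sup>L lborel (D k) = d k" for k
    using D_int by (auto simp: has_bochner_integral_iff)
  have summ: "summable (\<lambda>k. \<integral>p. norm (D k p) \<partial>lborel)"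
    using d_sums by (simp add: D_nonneg D_integral sums_iff)
  have ptw: "AE p in lborel. summable (\<lambda>k. norm (D k p))"
    using D_sums by (auto simp: D_nonneg sums_iff)
  have h_eq: "h = (\<lambda>p. \<Sum>k. D k p)"
    using D_sums by (auto simp: sums_iff)
  have "integrable lborel h"
    unfolding h_eq by (rule integrable_suminf[OF D_integrable ptw summ])
  moreover have "integral\<^sup>L lborel h = ln (4 / pi)"
    unfolding h_eq integral_suminf[OF D_integrable ptw summ] D_integral
    using d_sums by (simp add: sums_iff)
  ultimately show ?thesis
    using alternating_gap_sums
    by (simp add: set_integrable_def set_lebesgue_integral_def h_def[abs_def] gap_def Let_def)
qed

end
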